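(* Let $M\in\mathbb{N}$, $M\ge 1$, be fixed, and let $\Phi_h^{[M]}:(q,p)\mapsto(\tilde q,\tilde p)$ be the numerical flow of the $p$-implicit Symplectic Euler method with $M$ fixed point iterations for the Hamiltonian $H$. Set $$A_{\Phi}:=\tilde q_q^{T}\,\tilde p_p-\tilde p_q^{T}\,\tilde q_p ,$$ the upper right $N\times N$ block of $(D\Phi_h^{[M]})^TJ(D\Phi_h^{[M]})$. Then $$A_{\Phi}=I+\mathcal{O}(h^{M+1}),\qquad h\to 0 .$$
   Context: Let $N\ge 1$, let $\mathcal{D}\subset\mathbb{R}^N\times\mathbb{R}^N$ be compact and convex, and let $H=H(q,p)$ be a real-valued Hamiltonian which is sufficiently smooth on $\mathcal{D}$ (all derivatives exist and are continuous; concretely, $H$ is $C^\infty$ on an open neighbourhood of $\mathcal{D}$). $H_q,H_p$ denote the gradients of $H$ with respect to $q$ and $p$. $J=\begin{pmatrix}O&I\\-I&O\end{pmatrix}\in\mathbb{R}^{2N\times 2N}$, with $I$ the $N\times N$ identity. The $p$-implicit Symplectic Euler method with $M$ fixed point iterations and step $h>0$: given $(q,p)$, put $p_0:=p$, $p_{n+1}:=p-hH_q(q,p_n)$ for $n=0,\dots,M-1$, $\tilde p:=p_M$, $\tilde q:=q+hH_p(q,\tilde p)$; the numerical flow is $\Phi_h^{[M]}(q,p):=(\tilde q,\tilde p)$. The $N\times N$ matrices $\tilde q_q,\tilde q_p,\tilde p_q,\tilde p_p$ are the Jacobian blocks, e.g. $\tilde p_q=(\partial\tilde p_r/\partial q_s)_{r,s}$,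 and $D\Phi_h^{[M]}=\begin{pmatrix}\tilde q_q&\tilde q_p\\ \tilde p_q&\tilde p_p\end{pmatrix}$. Standing assumption: $S\subset\mathcal{D}$ is a set of initial values and $h_0>0$ is such that for all $0<h\le h_0$ and $(q,p)\in S$ all points at which $H$ and its derivatives are evaluated in the scheme, and the result of the step, lie in $\mathcal{D}$. A matrix depending on $h$ and $(q,p)$ is $\mathcal{O}(h^r)$ if its norm is at most $Ch^r$ for all sufficiently small $h\in(0,h_0]$ and all $(q,p)\in S$, with $C$ independent of $h$ and $(q,p)$ (it may depend on $H,\mathcal{D},M,N$). *)

theory Defs
  imports "HOL-Analysis.Analysis"
begin

(* On an open set this is the usual class C^k: for k + 1, f is Frechet differentiable
   and every directional derivative is C^k. *)
primrec C_k_on :: "nat \<Rightarrow> 'a::euclidean_space set \<Rightarrow> ('a \<Rightarrow> 'b::real_normed_vector) \<Rightarrow> bool" where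
  "C_k_on 0 U f \<longleftrightarrow> continuous_on U f"
| "C_k_on (Suc k) U f \<longleftrightarrow> (\<forall>x\<in>U. f differentiable (at x)) \<and>
     (\<forall>v. C_k_on k U (\<lambda>x. frechet_derivative f (at x) v))"

definition smooth_near :: "('a::euclidean_space \<Rightarrow> 'b::real_normed_vector) \<Rightarrow> 'a set \<Rightarrow> bool" where
  "smooth_near f D \<longleftrightarrow> (\<exists>U. open U \<and> D \<subseteq> U \<and> (\<forall>k. C_k_on k U f))"

definition gradient :: "(real^'n::finite \<Rightarrow> real) \<Rightarrow> real^'n \<Rightarrow> real^'n" where
  "gradient f x = (\<chi> i. frechet_derivative f (at x) (axis i 1))"

lemma gradient_eq_GDERIV: "GDERIV f x :> d \<Longrightarrow> gradient f x = d"
  unfolding gderiv_def gradient_def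
  by (drule frechet_derivative_at[symmetric]) (simp add: vec_eq_iff inner_axis')

type_synonym 'n hamiltonian = "(real^'n) \<times> (real^'n) \<Rightarrow> real"

definition grad_q :: "'n::finite hamiltonian \<Rightarrow> real^'n \<Rightarrow> real^'n \<Rightarrow> real^'n" where
  "grad_q H q p = gradient (\<lambda>q'. H (q', p)) q"

definition grad_p :: "'n::finite hamiltonian \<Rightarrow> real^'n \<Rightarrow> real^'n \<Rightarrow> real^'n" where
  "grad_p H q p = gradient (\<lambda>p'. H (q, p')) p"

primrec fp_iterate :: "'n::finite hamiltonian \<Rightarrow> real \<Rightarrow> real^'n \<Rightarrow> real^'n \<Rightarrow> nat \<Rightarrow> real^'n" where
  "fp_iterate H h q p 0 = p"
| "fp_iterate H h q p (Suc n) = p - h *\<^sub>R grad_q H q (fp_iterate H h q p n)"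

definition p_tilde :: "'n::finite hamiltonian \<Rightarrow> nat \<Rightarrow> real \<Rightarrow> real^'n \<Rightarrow> real^'n \<Rightarrow> real^'n" where
  "p_tilde H M h q p = fp_iterate H h q p M"

definition q_tilde :: "'n::finite hamiltonian \<Rightarrow> nat \<Rightarrow> real \<Rightarrow> real^'n \<Rightarrow> real^'n \<Rightarrow> real^'n" where
  "q_tilde H M h q p = q + h *\<^sub>R grad_p H q (p_tilde H M h q p)"

definition num_flow ::
  "'n::finite hamiltonian \<Rightarrow> nat \<Rightarrow> real \<Rightarrow> (real^'n) \<times> (real^'n) \<Rightarrow> (real^'n) \<times> (real^'n)" where
  "num_flow H M h = (\<lambda>(q, p). (q_tilde H M h q p, p_tilde H M h q p))"

definition jac_q :: "((real^'n) \<times> (real^'n) \<Rightarrow> real^'n) \<Rightarrow> (real^'n::finite) \<times> (real^'n) \<Rightarrow> real^'n^'n" where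
  "jac_q F = (\<lambda>(q, p). jacobian (\<lambda>q'. F (q', p)) (at q))"

definition jac_p :: "((real^'n) \<times> (real^'n) \<Rightarrow> real^'n) \<Rightarrow> (real^'n::finite) \<times> (real^'n) \<Rightarrow> real^'n^'n" where
  "jac_p F = (\<lambda>(q, p). jacobian (\<lambda>p'. F (q, p')) (at p))"

definition A_block ::
  "((real^'n) \<times> (real^'n) \<Rightarrow> (real^'n) \<times> (real^'n)) \<Rightarrow> (real^'n::finite) \<times> (real^'n) \<Rightarrow> real^'n^'n" where
  "A_block \<Phi> z =
     transpose (jac_q (fst \<circ> \<Phi>) z) ** jac_p (snd \<circ> \<Phi>) z
     - transpose (jac_q (snd \<circ> \<Phi>) z) ** jac_p (fst \<circ> \<Phi>) z"

(* 2N x 2N matrices are indexed by the sum type 'n + 'n: Inl for the q part, Inr for the p part. *)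
definition block_matrix ::
  "real^'n^'n \<Rightarrow> real^'n^'n \<Rightarrow> real^'n^'n \<Rightarrow> real^'n^'n \<Rightarrow> real^('n::finite + 'n)^('n + 'n)" where
  "block_matrix A B C D = (\<chi> i j.
     (case i of
        Inl k \<Rightarrow> (case j of Inl l \<Rightarrow> A $ k $ l | Inr l \<Rightarrow> B $ k $ l)
      | Inr k \<Rightarrow> (case j of Inl l \<Rightarrow> C $ k $ l | Inr l \<Rightarrow> D $ k $ l)))"

definition J_matrix :: "real^('n::finite + 'n)^('n + 'n)" where
  "J_matrix = block_matrix 0 (mat 1) (- mat 1) 0"

definition D_flow ::
  "((real^'n) \<times> (real^'n) \<Rightarrow> (real^'n) \<times> (real^'n)) \<Rightarrow> (real^'n::finite) \<times> (real^'n)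
     \<Rightarrow> real^('n + 'n)^('n + 'n)" where
  "D_flow \<Phi> z = block_matrix (jac_q (fst \<circ> \<Phi>) z) (jac_p (fst \<circ> \<Phi>) z)
                          (jac_q (snd \<circ> \<Phi>) z) (jac_p (snd \<circ> \<Phi>) z)"

lemma block_matrix_mult:
  "block_matrix A B C D ** block_matrix A' B' C' D' =
   block_matrix (A ** A' + B ** C') (A ** B' + B ** D') (C ** A' + D ** C') (C ** B' + D ** D')"
  unfolding UNIV_Plus_UNIV[symmetric]
  by (auto simp: vec_eq_iff matrix_matrix_mult_def block_matrix_def sum.Plus
        simp flip: UNIV_Plus_UNIV split: sum.split)

lemma transpose_block_matrix:
  "transpose (block_matrix A B C D) =
   block_matrix (transpose A) (transpose C) (transpose B) (transpose D)"
  by (auto simp: vec_eq_iff transpose_def block_matrix_def split: sum.split)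

lemma A_block_eq_upper_right_block:
  "A_block \<Phi> z $ i $ j =
     (transpose (D_flow \<Phi> z) ** J_matrix ** D_flow \<Phi> z) $ Inl i $ Inr j"
proof -
  have neg: "X ** - mat 1 = - X" for X :: "real^'n^'n"
    by (simp add: vec_eq_iff matrix_matrix_mult_def mat_def if_distrib[of uminus]
          if_distrib[of "\<lambda>x. _ * x"] sum_negf cong: if_cong)
  have neg': "(- X) ** Y = - (X ** Y)" for X Y :: "real^'n^'n"
    by (simp add: vec_eq_iff matrix_matrix_mult_def sum_negf)
  have "transpose (D_flow \<Phi> z) ** J_matrix ** D_flow \<Phi> z =
    block_matrix
      (transpose (jac_q (fst \<circ> \<Phi>) z) ** jac_q (snd \<circ> \<Phi>) z
        - transpose (jac_q (snd \<circ> \<Phi>) z) ** jac_q (fst \<circ> \<Phi>) z)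
      (A_block \<Phi> z)
      (transpose (jac_p (fst \<circ> \<Phi>) z) ** jac_q (snd \<circ> \<Phi>) z
        - transpose (jac_p (snd \<circ> \<Phi>) z) ** jac_q (fst \<circ> \<Phi>) z)
      (transpose (jac_p (fst \<circ> \<Phi>) z) ** jac_p (snd \<circ> \<Phi>) z
        - transpose (jac_p (snd \<circ> \<Phi>) z) ** jac_p (fst \<circ> \<Phi>) z)"
    unfolding D_flow_def J_matrix_def A_block_def
    by (simp add: transpose_block_matrix block_matrix_mult neg neg')
  then show ?thesis
    by (simp add: block_matrix_def)
qed

(* In one step H_q is evaluated at (q, p_n) for n < M, and H_p at (q, p_M). *)
definition step_admissible ::
  "'n::finite hamiltonian \<Rightarrow> ((real^'n) \<times> (real^'n)) set \<Rightarrow> nat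
     \<Rightarrow> ((real^'n) \<times> (real^'n)) set \<Rightarrow> real \<Rightarrow> bool" where
  "step_admissible H D M S h0 \<longleftrightarrow> S \<subseteq> D \<and> 0 < h0 \<and>
     (\<forall>h. 0 < h \<and> h \<le> h0 \<longrightarrow> (\<forall>(q, p)\<in>S.
        (\<forall>n\<le>M. (q, fp_iterate H h q p n) \<in> D) \<and> num_flow H M h (q, p) \<in> D))"

end

theory Submission imports Defs begin

text \<open>
Write \<open>p\<^sub>n\<close> for the iterates, \<open>P\<^sub>n = \<partial>p\<^sub>n/\<partial>p\<close>, \<open>Q = \<partial>p\<^sub>M/\<partial>q\<close> and
\<open>B\<^sub>n = H\<^sub>q\<^sub>p(q, p\<^sub>n)\<close>.  Differentiating \<open>q + h H\<^sub>p(q, p\<^sub>M)\<close> gives the blocks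
\<open>I + h (H\<^sub>p\<^sub>q + H\<^sub>p\<^sub>p Q)\<close> and \<open>h H\<^sub>p\<^sub>p P\<^sub>M\<close>.  In the block \<open>A\<close> the terms that
contain \<open>Q\<close> cancel because \<open>H\<^sub>p\<^sub>p\<close> is symmetric, and since \<open>H\<^sub>p\<^sub>q\<close> is the transpose of
\<open>H\<^sub>q\<^sub>p\<close> what remains is \<open>A = P\<^sub>M + h B\<^sub>M P\<^sub>M\<close> (lemma \<open>A_block_num_flow\<close>).  The
differentiated iteration \<open>P\<^sub>M = I - h B\<^bsub>M-1\<^esub> P\<^bsub>M-1\<^esub>\<close> turns this into the exact identity
\<open>A - I = h (B\<^sub>M P\<^sub>M - B\<^bsub>M-1\<^esub> P\<^bsub>M-1\<^esub>)\<close> (lemma \<open>A_block_num_flow_Suc\<close>): the defect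
from symplecticity is \<open>h\<close> times the difference of two successive stages of the fixed point
iteration.

The iteration map carries a factor \<open>h\<close>, so every iteration gains one order:
\<open>p\<^bsub>n+1\<^esub> - p\<^sub>n\<close>, \<open>P\<^bsub>n+1\<^esub> - P\<^sub>n\<close> and hence
\<open>B\<^bsub>n+1\<^esub> P\<^bsub>n+1\<^esub> - B\<^sub>n P\<^sub>n\<close> are \<open>O(h\<^bsup>n+1\<^esup>)\<close>
(lemmas \<open>stage_diff_big_O\<close> and \<open>Hqp_mult_dp_iterate_diff_big_O\<close>).  With \<open>n = M - 1\<close> and the
additional factor \<open>h\<close> the order is \<open>M + 1\<close>.  Apart from \<open>M\<close> and the dimension, the constants come from bounds and Lipschitz
constants of \<open>H\<^sub>q\<close> and \<open>H\<^sub>q\<^sub>p\<close> on \<open>D\<close>; these exist because \<open>D\<close> is compact and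
convex, and they do not depend on the set of initial values or on the range of step sizes.
\<close>

section \<open>Symmetry of the second derivative\<close>

lemma has_real_derivative_along_line:
  fixes f :: "'a::real_normed_vector \<Rightarrow> real"
  assumes "f differentiable (at (a + s *\<^sub>R v))"
  shows "((\<lambda>s. f (a + s *\<^sub>R v)) has_real_derivative frechet_derivative f (at (a + s *\<^sub>R v)) v) (at s)"
proof -
  have line: "((\<lambda>s. a + s *\<^sub>R v) has_derivative (\<lambda>u. u *\<^sub>R v)) (at s)"
    by (auto intro!: derivative_eq_intros)
  have "(f has_derivative frechet_derivative f (at (a + s *\<^sub>R v))) (at (a + s *\<^sub>R v))"
    using assms frechet_derivative_works by blast
  from diff_chain_at[OF line this]
  have "((\<lambda>s. f (a + s *\<^sub>R v)) has_derivative
      (\<lambda>u. frechet_derivative f (at (a + s *\<^sub>R v)) v * u)) (at s)"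
    by (simp add: o_def linear_scale[OF linear_frechet_derivative[OF assms]] mult.commute)
  then show ?thesis by (simp only: has_field_derivative_def)
qed

text \<open>
The mean value theorem in direction \<open>v\<close>, applied to the difference of \<open>f\<close> across \<open>t w\<close>, and then
in direction \<open>w\<close>.  The left-hand side does not change when \<open>v\<close> and \<open>w\<close> are exchanged, which is
what makes the mixed derivatives comparable.
\<close>

lemma second_difference_mean_value:
  fixes f :: "'a::real_normed_vector \<Rightarrow> real"
  assumes f: "\<And>y. y \<in> ball x \<delta> \<Longrightarrow> f differentiable (at y)"
    and fv: "\<And>y. y \<in> ball x \<delta> \<Longrightarrow> (\<lambda>y. frechet_derivative f (at y) v) differentiable (at y)"
    and t: "0 < t" "t * (norm v + norm w) < \<delta>"
  shows "\<exists>y\<in>ball x \<delta>. f (x + t *\<^sub>R v + t *\<^sub>R w) - f (x + t *\<^sub>R v) - f (x + t *\<^sub>R w) + f x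
    = t\<^sup>2 * frechet_derivative (\<lambda>y. frechet_derivative f (at y) v) (at y) w"
proof -
  let ?d = "\<lambda>y. frechet_derivative f (at y) v"
  let ?d2 = "\<lambda>y. frechet_derivative ?d (at y) w"
  have near: "x + s *\<^sub>R v + r *\<^sub>R w \<in> ball x \<delta>" if "0 \<le> s" "s \<le> t" "0 \<le> r" "r \<le> t" for s r
  proof -
    have "norm (s *\<^sub>R v + r *\<^sub>R w) \<le> s * norm v + r * norm w"
      using norm_triangle_ineq[of "s *\<^sub>R v" "r *\<^sub>R w"] that by simp
    also have "\<dots> \<le> t * norm v + t * norm w"
      using that by (intro add_mono mult_right_mono) auto
    also have "\<dots> < \<delta>" using t by (simp add: algebra_simps)
    finally have "dist (x + s *\<^sub>R v + r *\<^sub>R w) x < \<delta>" by (simp add: dist_norm)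
    then show ?thesis by (simp only: mem_ball dist_commute)
  qed
  have along_v: "((\<lambda>s. f (x + s *\<^sub>R v + r *\<^sub>R w)) has_real_derivative ?d (x + s *\<^sub>R v + r *\<^sub>R w)) (at s)"
    if "0 \<le> s" "s \<le> t" "0 \<le> r" "r \<le> t" for s r
    using has_real_derivative_along_line[of f "x + r *\<^sub>R w" s v] f[OF near[OF that]]
    by (simp add: ac_simps)
  have along_w: "((\<lambda>r. ?d (x + s *\<^sub>R v + r *\<^sub>R w)) has_real_derivative ?d2 (x + s *\<^sub>R v + r *\<^sub>R w)) (at r)"
    if "0 \<le> s" "s \<le> t" "0 \<le> r" "r \<le> t" for s r
    using has_real_derivative_along_line[of ?d "x + s *\<^sub>R v" r w] fv[OF near[OF that]]
    by simp
  have "((\<lambda>s. f (x + s *\<^sub>R v + t *\<^sub>R w) - f (x + s *\<^sub>R v + 0 *\<^sub>R w)) has_real_derivative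
      ?d (x + s *\<^sub>R v + t *\<^sub>R w) - ?d (x + s *\<^sub>R v + 0 *\<^sub>R w)) (at s)" if "0 \<le> s" "s \<le> t" for s
    by (intro DERIV_diff along_v) (use that t(1) in auto)
  from MVT2[OF t(1) this] obtain \<xi> where \<xi>: "0 < \<xi>" "\<xi> < t" and
    first: "f (x + t *\<^sub>R v + t *\<^sub>R w) - f (x + t *\<^sub>R v) - (f (x + t *\<^sub>R w) - f x)
      = t * (?d (x + \<xi> *\<^sub>R v + t *\<^sub>R w) - ?d (x + \<xi> *\<^sub>R v))"
    by auto
  have "((\<lambda>r. ?d (x + \<xi> *\<^sub>R v + r *\<^sub>R w)) has_real_derivative
      ?d2 (x + \<xi> *\<^sub>R v + r *\<^sub>R w)) (at r)" if "0 \<le> r" "r \<le> t" for r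
    by (intro along_w) (use that \<xi> in auto)
  from MVT2[OF t(1) this] obtain \<eta> where \<eta>: "0 < \<eta>" "\<eta> < t" and
    second: "?d (x + \<xi> *\<^sub>R v + t *\<^sub>R w) - ?d (x + \<xi> *\<^sub>R v) = t * ?d2 (x + \<xi> *\<^sub>R v + \<eta> *\<^sub>R w)"
    by auto
  have "f (x + t *\<^sub>R v + t *\<^sub>R w) - f (x + t *\<^sub>R v) - f (x + t *\<^sub>R w) + f x
      = t\<^sup>2 * ?d2 (x + \<xi> *\<^sub>R v + \<eta> *\<^sub>R w)"
    using first unfolding second by (simp add: power2_eq_square)
  then show ?thesis
    using near[of \<xi> \<eta>] \<xi> \<eta> by (meson less_imp_le)
qed

definition hessian :: "('a::euclidean_space \<Rightarrow> real) \<Rightarrow> 'a \<Rightarrow> 'a \<Rightarrow> 'a \<Rightarrow> real" where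
  "hessian f v w x = frechet_derivative (\<lambda>y. frechet_derivative f (at y) v) (at x) w"

text \<open>
Both orders of differentiation are values, at points near \<open>x\<close>, of one and the same second
difference quotient; by continuity they agree at \<open>x\<close>.
\<close>

lemma hessian_symmetric:
  fixes f :: "'a::euclidean_space \<Rightarrow> real"
  assumes "open U" "x \<in> U" and C2: "C_k_on 2 U f"
  shows "hessian f v w x = hessian f w v x"
proof (rule ccontr)
  assume ne: "hessian f v w x \<noteq> hessian f w v x"
  define e where "e = \<bar>hessian f v w x - hessian f w v x\<bar> / 2"
  have "e > 0" using ne by (simp add: e_def)
  have diff: "f differentiable (at y)" "(\<lambda>y. frechet_derivative f (at y) u) differentiable (at y)"
    if "y \<in> U" for y u
    using C2 that by (auto simp: numeral_2_eq_2)
  have cont: "continuous_on U (hessian f u u')" for u u'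
    using C2 unfolding hessian_def[abs_def] by (auto simp: numeral_2_eq_2)
  have "\<forall>\<^sub>F y in nhds x. y \<in> U" using assms by (simp add: eventually_nhds_in_open)
  moreover have "\<forall>\<^sub>F y in nhds x. dist (hessian f u u' y) (hessian f u u' x) < e" for u u'
    using cont[of u u'] \<open>e > 0\<close> assms(1,2)
    by (intro tendstoD) (auto simp: continuous_on_eq_continuous_at isCont_def tendsto_at_iff_tendsto_nhds)
  ultimately have "\<forall>\<^sub>F y in nhds x. y \<in> U \<and> dist (hessian f v w y) (hessian f v w x) < e
      \<and> dist (hessian f w v y) (hessian f w v x) < e"
    by (intro eventually_conj)
  then obtain \<delta> where "\<delta> > 0" and ball: "\<And>y. y \<in> ball x \<delta> \<Longrightarrow> y \<in> U \<and>
      dist (hessian f v w y) (hessian f v w x) < e \<and> dist (hessian f w v y) (hessian f w v x) < e"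
    unfolding eventually_nhds_metric by (auto simp: dist_commute)
  \<comment> \<open>the summand 1 gives a valid \<open>t\<close> even for \<open>v = w = 0\<close>\<close>
  define t where "t = \<delta> / (norm v + norm w + 1)"
  have pos: "norm v + norm w + 1 > 0" by (simp add: add_nonneg_pos)
  have t: "t > 0" "t * (norm v + norm w) < \<delta>"
    using \<open>\<delta> > 0\<close> pos by (simp_all add: t_def field_simps)
  obtain y where y: "y \<in> ball x \<delta>" and
    "f (x + t *\<^sub>R v + t *\<^sub>R w) - f (x + t *\<^sub>R v) - f (x + t *\<^sub>R w) + f x = t\<^sup>2 * hessian f v w y"
    using second_difference_mean_value[of x \<delta> f v t w] ball diff t unfolding hessian_def by blast
  moreover obtain y' where y': "y' \<in> ball x \<delta>" and
    "f (x + t *\<^sub>R w + t *\<^sub>R v) - f (x + t *\<^sub>R w) - f (x + t *\<^sub>R v) + f x = t\<^sup>2 * hessian f w v y'"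
    using second_difference_mean_value[of x \<delta> f w t v] ball diff t unfolding hessian_def
    by (metis add.commute)
  ultimately have "t\<^sup>2 * hessian f v w y = t\<^sup>2 * hessian f w v y'"
    by (simp add: algebra_simps)
  then have "hessian f v w y = hessian f w v y'" using t by simp
  with ball[OF y] ball[OF y'] show False
    by (simp add: e_def dist_real_def abs_if split: if_splits)
qed

section \<open>Lipschitz bounds from smoothness on a compact convex set\<close>

text \<open>
The partial derivatives are bounded on \<open>D\<close> by compactness, so the operator norm of the derivative
is; convexity lets the mean value inequality connect any two points inside \<open>D\<close>.
\<close>

lemma lipschitz_on_compact_convex:
  fixes f :: "'a::euclidean_space \<Rightarrow> 'b::real_normed_vector"
  assumes C1: "C_k_on (Suc 0) U f" and "compact D" "convex D" "D \<subseteq> U"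
  shows "\<exists>L. L-lipschitz_on D f"
proof -
  have "\<exists>B. \<forall>x\<in>D. norm (frechet_derivative f (at x) b) \<le> B" for b
  proof -
    have "continuous_on D (\<lambda>x. frechet_derivative f (at x) b)"
      using C1 \<open>D \<subseteq> U\<close> by (auto intro: continuous_on_subset)
    then have "bounded ((\<lambda>x. frechet_derivative f (at x) b) ` D)"
      using \<open>compact D\<close> compact_continuous_image compact_imp_bounded by blast
    then show ?thesis by (auto simp: bounded_iff)
  qed
  then obtain B where B: "\<And>b x. x \<in> D \<Longrightarrow> norm (frechet_derivative f (at x) b) \<le> B b"
    by metis
  define L where "L = \<bar>\<Sum>b\<in>Basis. B b\<bar>"
  have diff: "f differentiable (at x)" if "x \<in> D" for x
    using C1 \<open>D \<subseteq> U\<close> that by auto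
  have on: "onorm (frechet_derivative f (at x)) \<le> L" if "x \<in> D" for x
  proof (rule onorm_bound)
    fix u :: 'a
    interpret linear "frechet_derivative f (at x)"
      using diff[OF that] by (rule linear_frechet_derivative)
    have "frechet_derivative f (at x) u = (\<Sum>b\<in>Basis. (u \<bullet> b) *\<^sub>R frechet_derivative f (at x) b)"
      by (subst (1) euclidean_representation[of u, symmetric]) (simp add: sum scale)
    also have "norm \<dots> \<le> (\<Sum>b\<in>Basis. norm u * B b)"
      using B[OF that] by (intro order_trans[OF norm_sum] sum_mono)
        (auto intro!: mult_mono Basis_le_norm)
    also have "\<dots> \<le> L * norm u"
      by (simp add: L_def sum_distrib_left[symmetric] mult.commute[of _ "norm u"] mult_left_mono)
    finally show "norm (frechet_derivative f (at x) u) \<le> L * norm u" .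
  qed (simp add: L_def)
  have "L-lipschitz_on D f"
  proof (rule lipschitz_onI)
    fix x y assume "x \<in> D" "y \<in> D"
    then show "dist (f x) (f y) \<le> L * dist x y"
      using differentiable_bound[of D f "\<lambda>x. frechet_derivative f (at x)" L x y] on \<open>convex D\<close> diff
      by (auto simp: dist_norm frechet_derivative_works[symmetric] intro: has_derivative_at_withinI
          dest: frechet_derivative_works[THEN iffD1])
  qed (simp add: L_def)
  then show ?thesis by blast
qed

lemma lipschitz_on_vec_lambda:
  fixes g :: "'n::finite \<Rightarrow> 'a::metric_space \<Rightarrow> 'b::real_normed_vector"
  assumes "\<And>i. \<exists>L. L-lipschitz_on D (g i)"
  shows "\<exists>L. L-lipschitz_on D (\<lambda>x. \<chi> i. g i x)"
proof -
  obtain L where L: "\<And>i. (L i)-lipschitz_on D (g i)" using assms by metis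
  have "(\<Sum>i\<in>UNIV. L i)-lipschitz_on D (\<lambda>x. \<chi> i. g i x)"
  proof (rule lipschitz_onI)
    fix x y assume xy: "x \<in> D" "y \<in> D"
    have "dist (\<chi> i. g i x) (\<chi> i. g i y) \<le> (\<Sum>i\<in>UNIV. dist (g i x) (g i y))"
      unfolding dist_vec_def by (rule order_trans[OF L2_set_le_sum]) auto
    also have "\<dots> \<le> (\<Sum>i\<in>UNIV. L i * dist x y)"
      using lipschitz_onD[OF L] xy by (intro sum_mono)
    finally show "dist (\<chi> i. g i x) (\<chi> i. g i y) \<le> (\<Sum>i\<in>UNIV. L i) * dist x y"
      by (simp add: sum_distrib_right)
  qed (use lipschitz_on_nonneg[OF L] in \<open>auto intro: sum_nonneg\<close>)
  then show ?thesis by blast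
qed

section \<open>Hessian blocks and the derivatives of the partial gradients\<close>

text \<open>
The partial gradients \<open>H\<^sub>q\<close> and \<open>H\<^sub>p\<close> are the instances in which \<open>e\<close> lists the coordinate axes of
the respective half of phase space.  Taken from the total derivative of \<open>f\<close>, they can be
differentiated in all variables at once.
\<close>

definition directional_gradient ::
    "('a::euclidean_space \<Rightarrow> real) \<Rightarrow> ('n::finite \<Rightarrow> 'a) \<Rightarrow> 'a \<Rightarrow> real^'n" where
  "directional_gradient f e x = (\<chi> i. frechet_derivative f (at x) (e i))"

text \<open>
The derivative of the gradient along \<open>d\<close> in the variables of \<open>e\<close>: the block \<open>H\<^sub>q\<^sub>p\<close>, which is the
Jacobian of \<open>H\<^sub>q\<close> in \<open>p\<close>, is \<open>hessian_block H q_axis p_axis\<close>.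
\<close>

definition hessian_block ::
    "('a::euclidean_space \<Rightarrow> real) \<Rightarrow> ('n::finite \<Rightarrow> 'a) \<Rightarrow> ('m::finite \<Rightarrow> 'a) \<Rightarrow> 'a \<Rightarrow> real^'m^'n" where
  "hessian_block f d e x = (\<chi> i j. hessian f (d i) (e j) x)"

abbreviation q_axis :: "'n::finite \<Rightarrow> (real^'n) \<times> (real^'n)" where
  "q_axis i \<equiv> (axis i 1, 0)"

abbreviation p_axis :: "'n::finite \<Rightarrow> (real^'n) \<times> (real^'n)" where
  "p_axis i \<equiv> (0, axis i 1)"

lemma C2_differentiable:
  assumes "C_k_on 2 U f" "x \<in> U"
  shows "f differentiable (at x)" "(\<lambda>x. frechet_derivative f (at x) v) differentiable (at x)"
proof -
  have "\<forall>v. C_k_on (Suc 0) U (\<lambda>x. frechet_derivative f (at x) v)" "\<forall>x\<in>U. f differentiable (at x)"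
    using assms(1) unfolding numeral_2_eq_2 C_k_on.simps(2)[of "Suc 0"] by blast+
  then show "f differentiable (at x)" "(\<lambda>x. frechet_derivative f (at x) v) differentiable (at x)"
    using assms(2) unfolding C_k_on.simps by blast+
qed

lemma C_k_on_Suc_derivative:
  "C_k_on (Suc k) U f \<Longrightarrow> C_k_on k U (\<lambda>x. frechet_derivative f (at x) v)"
  by simp

lemma transpose_hessian_block:
  assumes "open U" "x \<in> U" "C_k_on 2 U f"
  shows "transpose (hessian_block f d e x) = hessian_block f e d x"
  unfolding hessian_block_def transpose_def vec_eq_iff vec_lambda_beta
  by (intro allI hessian_symmetric[OF assms])

lemma grad_q_eq_directional_gradient:
  assumes "H differentiable (at (q, p))"
  shows "grad_q H q p = directional_gradient H q_axis (q, p)"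
proof -
  have "(H has_derivative frechet_derivative H (at (q, p))) (at (q, p))"
    using assms frechet_derivative_works by blast
  then have "((\<lambda>q'. H (q', p)) has_derivative (\<lambda>u. frechet_derivative H (at (q, p)) (u, 0))) (at q)"
    using diff_chain_at[of "\<lambda>q'. (q', p)" "\<lambda>u. (u, 0)" q H "frechet_derivative H (at (q, p))"]
    by (simp add: o_def has_derivative_Pair)
  from frechet_derivative_at[OF this, symmetric] show ?thesis
    by (simp add: grad_q_def gradient_def directional_gradient_def)
qed

lemma grad_p_eq_directional_gradient:
  assumes "H differentiable (at (q, p))"
  shows "grad_p H q p = directional_gradient H p_axis (q, p)"
proof -
  have "(H has_derivative frechet_derivative H (at (q, p))) (at (q, p))"
    using assms frechet_derivative_works by blast
  then have "((\<lambda>p'. H (q, p')) has_derivative (\<lambda>u. frechet_derivative H (at (q, p)) (0, u))) (at p)"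
    using diff_chain_at[of "\<lambda>p'. (q, p')" "\<lambda>u. (0, u)" p H "frechet_derivative H (at (q, p))"]
    by (simp add: o_def has_derivative_Pair)
  from frechet_derivative_at[OF this, symmetric] show ?thesis
    by (simp add: grad_p_def gradient_def directional_gradient_def)
qed

lemma linear_as_axis_sum:
  fixes f :: "(real^'n) \<times> (real^'n) \<Rightarrow> real"
  assumes "linear f"
  shows "f (u, v) = (\<Sum>j\<in>UNIV. f (q_axis j) * u $ j) + (\<Sum>j\<in>UNIV. f (p_axis j) * v $ j)"
proof -
  interpret linear f by (fact assms)
  have "(u, v) = (\<Sum>j\<in>UNIV. u $ j *\<^sub>R q_axis j) + (\<Sum>j\<in>UNIV. v $ j *\<^sub>R p_axis j)"
    using basis_expansion[of u] basis_expansion[of v]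
    by (simp add: prod_eq_iff fst_sum snd_sum scalar_mult_eq_scaleR)
  then have "f (u, v) = f ((\<Sum>j\<in>UNIV. u $ j *\<^sub>R q_axis j) + (\<Sum>j\<in>UNIV. v $ j *\<^sub>R p_axis j))"
    by simp
  also have "\<dots> = (\<Sum>j\<in>UNIV. u $ j *\<^sub>R f (q_axis j)) + (\<Sum>j\<in>UNIV. v $ j *\<^sub>R f (p_axis j))"
    by (simp only: add sum scale)
  finally show ?thesis by (simp add: mult.commute)
qed

text \<open>
The chain rule for the iterates needs the total derivative of the partial gradients, since
\<open>q\<close> enters both directly and through \<open>p\<^sub>n\<close>.
\<close>

lemma has_derivative_directional_gradient:
  fixes f :: "(real^'n) \<times> (real^'n) \<Rightarrow> real"
  assumes "C_k_on 2 U f" "x \<in> U"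
  shows "(directional_gradient f e has_derivative
     (\<lambda>(u, v). hessian_block f e q_axis x *v u + hessian_block f e p_axis x *v v)) (at x)"
proof -
  have "((\<lambda>x. directional_gradient f e x $ i) has_derivative
     (\<lambda>w. (case w of (u, v) \<Rightarrow> hessian_block f e q_axis x *v u + hessian_block f e p_axis x *v v) $ i)) (at x)"
    for i
  proof -
    have "(\<lambda>x. frechet_derivative f (at x) (e i)) differentiable (at x)"
      using C2_differentiable(2)[OF assms] .
    then have "((\<lambda>x. directional_gradient f e x $ i) has_derivative (\<lambda>w. hessian f (e i) w x)) (at x)"
      "linear (\<lambda>w. hessian f (e i) w x)"
      unfolding directional_gradient_def hessian_def vec_lambda_beta
      by (blast dest: frechet_derivative_works[THEN iffD1], blast dest: linear_frechet_derivative)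
    moreover have "hessian f (e i) (u, v) x
        = (hessian_block f e q_axis x *v u + hessian_block f e p_axis x *v v) $ i" for u v
      unfolding linear_as_axis_sum[OF calculation(2), of u v]
      by (simp add: hessian_block_def matrix_vector_mult_def)
    then have "(\<lambda>w. hessian f (e i) w x) = (\<lambda>w. (case w of (u, v) \<Rightarrow>
        hessian_block f e q_axis x *v u + hessian_block f e p_axis x *v v) $ i)"
      by (auto simp: fun_eq_iff)
    ultimately show ?thesis by simp
  qed
  then show ?thesis
    by (subst has_derivative_componentwise_within) (auto simp: Basis_vec_def inner_axis)
qed

lemma has_derivative_grad:
  assumes "open U" "C_k_on 2 U H" "(q, p) \<in> U"
  shows "((\<lambda>(q, p). grad_q H q p) has_derivative
     (\<lambda>(u, v). hessian_block H q_axis q_axis (q, p) *v u + hessian_block H q_axis p_axis (q, p) *v v)) (at (q, p))"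
    and "((\<lambda>(q, p). grad_p H q p) has_derivative
     (\<lambda>(u, v). hessian_block H p_axis q_axis (q, p) *v u + hessian_block H p_axis p_axis (q, p) *v v)) (at (q, p))"
  using assms
  by (auto intro!: has_derivative_transform_within_open[OF has_derivative_directional_gradient]
      simp: grad_q_eq_directional_gradient grad_p_eq_directional_gradient C2_differentiable(1))

section \<open>The Jacobian blocks of the numerical flow\<close>

lemma bounded_bilinear_matrix_mult:
  "bounded_bilinear (\<lambda>(A :: real^'m^'n) (B :: real^'k^'m). A ** B)"
  unfolding bilinear_conv_bounded_bilinear[symmetric] bilinear_def
  by (auto intro!: linearI simp: matrix_matrix_mult_def vec_eq_iff algebra_simps sum.distrib
       sum_distrib_left)

lemma jacobian_eqI: "(f has_derivative (\<lambda>v. A *v v)) (at x) \<Longrightarrow> jacobian f (at x) = A"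
  using frechet_derivative_at[of f "\<lambda>v. A *v v" x, symmetric] by (simp add: jacobian_def matrix_def matrix_vector_mult_def axis_def vec_eq_iff
      if_distrib[of "\<lambda>x. _ * x"] cong: if_cong)

text \<open>
The recursion for the iterates, differentiated with respect to the initial \<open>p\<close>.  As an explicit
recursion it can be estimated step by step; that it is the Jacobian of the iterate is
\<open>fp_iterate_has_derivative_p\<close>.
\<close>

primrec dp_iterate ::
    "'n::finite hamiltonian \<Rightarrow> real \<Rightarrow> real^'n \<Rightarrow> real^'n \<Rightarrow> nat \<Rightarrow> real^'n^'n" where
  "dp_iterate H h q p 0 = mat 1"
| "dp_iterate H h q p (Suc n) =
     mat 1 - h *\<^sub>R (hessian_block H q_axis p_axis (q, fp_iterate H h q p n) ** dp_iterate H h q p n)"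

lemma fp_iterate_has_derivative_p:
  assumes "open U" "C_k_on 2 U H" "\<And>k. k < n \<Longrightarrow> (q, fp_iterate H h q p k) \<in> U"
  shows "((\<lambda>p'. fp_iterate H h q p' n) has_derivative (\<lambda>v. dp_iterate H h q p n *v v)) (at p)"
  using assms(3)
proof (induction n)
  case 0
  show ?case by simp
next
  case (Suc n)
  let ?x = "(q, fp_iterate H h q p n)"
  have "((\<lambda>p'. (q, fp_iterate H h q p' n)) has_derivative (\<lambda>v. (0, dp_iterate H h q p n *v v))) (at p)"
    using Suc by (auto intro!: derivative_eq_intros)
  from diff_chain_at[OF this has_derivative_grad(1)[OF assms(1,2) Suc.prems]]
  have "((\<lambda>p'. grad_q H q (fp_iterate H h q p' n)) has_derivative
      (\<lambda>v. hessian_block H q_axis p_axis ?x *v (dp_iterate H h q p n *v v))) (at p)"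
    by (simp add: o_def)
  then show ?case
    by (auto intro!: derivative_eq_intros simp: matrix_vector_mult_diff_rdistrib
        matrix_vector_mul_assoc scaleR_matrix_vector_assoc)
qed

text \<open>
Differentiability suffices here, without a formula for the Jacobian block, because this block cancels
in \<open>A_block\<close>.
\<close>

lemma fp_iterate_differentiable_q:
  assumes "open U" "C_k_on 2 U H" "\<And>k. k < n \<Longrightarrow> (q, fp_iterate H h q p k) \<in> U"
  shows "(\<lambda>q'. fp_iterate H h q' p n) differentiable (at q)"
  using assms(3)
proof (induction n)
  case 0
  show ?case by simp
next
  case (Suc n)
  then have "(\<lambda>q'. (q', fp_iterate H h q' p n)) differentiable (at q)"
    by (intro differentiable_Pair) auto
  moreover have "(\<lambda>(q, p). grad_q H q p) differentiable (at (q, fp_iterate H h q p n))"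
    using has_derivative_grad(1)[OF assms(1,2) Suc.prems] by (auto simp: differentiable_def)
  ultimately have "(\<lambda>q'. grad_q H q' (fp_iterate H h q' p n)) differentiable (at q)"
    using differentiable_chain_at[of "\<lambda>q'. (q', fp_iterate H h q' p n)" q "\<lambda>(q, p). grad_q H q p"]
    by (simp add: o_def)
  then show ?case by simp
qed

text \<open>
The terms with \<open>Q\<close> are \<open>h Q\<^sup>T H\<^sub>p\<^sub>p\<^sup>T P\<^sub>M\<close> from the first product and \<open>h Q\<^sup>T H\<^sub>p\<^sub>p P\<^sub>M\<close> from the
second one; symmetry of \<open>H\<^sub>p\<^sub>p\<close> cancels them.
\<close>

lemma A_block_num_flow:
  fixes H :: "'n::finite hamiltonian"
  assumes U: "open U" "C_k_on 2 U H" "\<And>k. k \<le> M \<Longrightarrow> (q, fp_iterate H h q p k) \<in> U"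
  defines "x \<equiv> (q, fp_iterate H h q p M)"
  shows "A_block (num_flow H M h) (q, p) =
    dp_iterate H h q p M + h *\<^sub>R (hessian_block H q_axis p_axis x ** dp_iterate H h q p M)"
proof -
  let ?P = "dp_iterate H h q p M"
  define Q where "Q = jacobian (\<lambda>q'. fp_iterate H h q' p M) (at q)"
  let ?pq = "hessian_block H p_axis q_axis x" and ?pp = "hessian_block H p_axis p_axis x"
  have p_q: "((\<lambda>q'. fp_iterate H h q' p M) has_derivative (\<lambda>u. Q *v u)) (at q)"
    unfolding Q_def using fp_iterate_differentiable_q[OF U(1,2)] U(3) by (simp flip: jacobian_works)
  have p_p: "((\<lambda>p'. fp_iterate H h q p' M) has_derivative (\<lambda>v. ?P *v v)) (at p)"
    using fp_iterate_has_derivative_p[OF U(1,2)] U(3) by simp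
  note grad = has_derivative_grad(2)[OF U(1,2) U(3)[OF order_refl]]
  have "((\<lambda>q'. (q', fp_iterate H h q' p M)) has_derivative (\<lambda>u. (u, Q *v u))) (at q)"
    using p_q by (auto intro!: derivative_eq_intros)
  from diff_chain_at[OF this grad]
  have "((\<lambda>q'. grad_p H q' (fp_iterate H h q' p M)) has_derivative
      (\<lambda>u. ?pq *v u + ?pp *v (Q *v u))) (at q)"
    by (simp add: o_def x_def)
  then have q_q: "((\<lambda>q'. q' + h *\<^sub>R grad_p H q' (fp_iterate H h q' p M)) has_derivative
      (\<lambda>u. (mat 1 + h *\<^sub>R (?pq + ?pp ** Q)) *v u)) (at q)"
    by (auto intro!: derivative_eq_intros simp: matrix_vector_mult_add_rdistrib
        matrix_vector_mul_assoc simp flip: scaleR_matrix_vector_assoc)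
  have "((\<lambda>p'. (q, fp_iterate H h q p' M)) has_derivative (\<lambda>v. (0, ?P *v v))) (at p)"
    using p_p by (auto intro!: derivative_eq_intros)
  from diff_chain_at[OF this grad]
  have "((\<lambda>p'. grad_p H q (fp_iterate H h q p' M)) has_derivative (\<lambda>v. ?pp *v (?P *v v))) (at p)"
    by (simp add: o_def x_def)
  then have q_p: "((\<lambda>p'. q + h *\<^sub>R grad_p H q (fp_iterate H h q p' M)) has_derivative
      (\<lambda>v. (h *\<^sub>R (?pp ** ?P)) *v v)) (at p)"
    by (auto intro!: derivative_eq_intros simp: 
        matrix_vector_mul_assoc simp flip: scaleR_matrix_vector_assoc)
  have "x \<in> U" using U(3) by (simp add: x_def)
  then have sym: "transpose ?pq = hessian_block H q_axis p_axis x" "transpose ?pp = ?pp"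
    by (rule transpose_hessian_block[OF U(1) _ U(2)])+
  interpret mm: bounded_bilinear "\<lambda>(A :: real^'n^'n) (B :: real^'n^'n). A ** B"
    by (rule bounded_bilinear_matrix_mult)
  have transpose_add: "transpose (A + B) = transpose A + transpose B" for A B :: "real^'n^'n"
    by (simp add: transpose_def vec_eq_iff)
  have "A_block (num_flow H M h) (q, p) =
      transpose (mat 1 + h *\<^sub>R (?pq + ?pp ** Q)) ** ?P - transpose Q ** (h *\<^sub>R (?pp ** ?P))"
    using jacobian_eqI[OF q_q] jacobian_eqI[OF q_p] jacobian_eqI[OF p_p] Q_def
    by (simp add: A_block_def jac_q_def jac_p_def num_flow_def o_def q_tilde_def p_tilde_def)
  also have "\<dots> = ?P + h *\<^sub>R (hessian_block H q_axis p_axis x ** ?P)"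
    by (simp add: transpose_add transpose_scalar matrix_transpose_mul sym mm.add_left mm.scaleR_left
        mm.scaleR_right scaleR_add_right matrix_mul_assoc)
  finally show ?thesis .
qed

text \<open>
The identity matrix comes from the leading \<open>P\<^sub>M\<close> alone, by one step of the differentiated
iteration.
\<close>

lemma A_block_num_flow_Suc:
  assumes "open U" "C_k_on 2 U H" "\<And>k. k \<le> Suc m \<Longrightarrow> (q, fp_iterate H h q p k) \<in> U"
  defines "HP \<equiv> \<lambda>k. hessian_block H q_axis p_axis (q, fp_iterate H h q p k) ** dp_iterate H h q p k"
  shows "A_block (num_flow H (Suc m) h) (q, p) - mat 1 = h *\<^sub>R (HP (Suc m) - HP m)"
  using A_block_num_flow[OF assms(1-3)] by (simp add: HP_def scaleR_diff_right)

section \<open>Uniform order in the step size\<close>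

text \<open>
\<open>T\<close> collects pairs of a step size and a phase point, so that the constant is uniform in both and the
admissible points may depend on the step size.
\<close>

definition big_O :: "(real \<times> 'z) set \<Rightarrow> nat \<Rightarrow> (real \<Rightarrow> 'z \<Rightarrow> 'b::real_normed_vector) \<Rightarrow> bool" where
  "big_O T r f \<longleftrightarrow> (\<exists>C. \<forall>(h, z)\<in>T. norm (f h z) \<le> C * h ^ r)"

lemma big_O_subset: "big_O T r f \<Longrightarrow> T' \<subseteq> T \<Longrightarrow> big_O T' r f"
  unfolding big_O_def by blast

lemma big_O_cong:
  "(\<And>h z. (h, z) \<in> T \<Longrightarrow> f h z = g h z) \<Longrightarrow> big_O T r f \<longleftrightarrow> big_O T r g"
  by (auto simp: big_O_def split: prod.splits intro!: ex_cong1 ball_cong)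

lemma big_O_add:
  assumes "big_O T r f" "big_O T r g"
  shows "big_O T r (\<lambda>h z. f h z + g h z)"
proof -
  obtain C C' where "\<forall>(h, z)\<in>T. norm (f h z) \<le> C * h ^ r" "\<forall>(h, z)\<in>T. norm (g h z) \<le> C' * h ^ r"
    using assms unfolding big_O_def by blast
  then have "\<forall>(h, z)\<in>T. norm (f h z + g h z) \<le> (C + C') * h ^ r"
    by (fastforce simp: distrib_right intro: norm_triangle_le add_mono)
  then show ?thesis unfolding big_O_def by blast
qed

lemma big_O_diff:
  assumes "big_O T r f" "big_O T r g"
  shows "big_O T r (\<lambda>h z. f h z - g h z)"
  using big_O_add[of T r f "\<lambda>h z. - g h z"] assms by (simp add: big_O_def)

lemma big_O_const: "big_O T 0 (\<lambda>h z. c)"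
  by (auto simp: big_O_def)

lemma big_O_step:
  assumes "big_O T r f" "T \<subseteq> {0..1} \<times> UNIV"
  shows "big_O T (Suc r) (\<lambda>h z. h *\<^sub>R f h z)"
proof -
  obtain C where C: "\<forall>(h, z)\<in>T. norm (f h z) \<le> C * h ^ r"
    using assms unfolding big_O_def by blast
  have "norm (h *\<^sub>R f h z) \<le> C * h ^ Suc r" if "(h, z) \<in> T" for h z
  proof -
    have "0 \<le> h" "norm (f h z) \<le> C * h ^ r" using assms(2) C that by auto
    then show ?thesis using mult_left_mono[of "norm (f h z)" "C * h ^ r" h] by (simp add: ac_simps)
  qed
  then show ?thesis unfolding big_O_def by blast
qed

lemma big_O_Suc_imp:
  assumes "big_O T (Suc r) f" "T \<subseteq> {0..1} \<times> UNIV"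
  shows "big_O T r f"
proof -
  obtain C where C: "\<forall>(h, z)\<in>T. norm (f h z) \<le> C * h ^ Suc r"
    using assms unfolding big_O_def by blast
  have "norm (f h z) \<le> \<bar>C\<bar> * h ^ r" if "(h, z) \<in> T" for h z
  proof -
    have h: "0 \<le> h" "h \<le> 1" "norm (f h z) \<le> C * h ^ Suc r" using assms(2) C that by auto
    have "C * h ^ Suc r \<le> \<bar>C\<bar> * h ^ r"
      using h by (intro mult_mono power_decreasing) auto
    then show ?thesis using h by linarith
  qed
  then show ?thesis unfolding big_O_def by blast
qed

lemma (in bounded_bilinear) big_O_prod:
  assumes "big_O T r f" "big_O T s g" "T \<subseteq> {0..1} \<times> UNIV"
  shows "big_O T (r + s) (\<lambda>h z. prod (f h z) (g h z))"
proof -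
  obtain C C' where C: "\<forall>(h, z)\<in>T. norm (f h z) \<le> C * h ^ r" "\<forall>(h, z)\<in>T. norm (g h z) \<le> C' * h ^ s"
    using assms unfolding big_O_def by blast
  obtain K where K: "K \<ge> 0" "\<And>a b. norm (prod a b) \<le> norm a * norm b * K"
    using nonneg_bounded by blast
  have "norm (prod (f h z) (g h z)) \<le> (C * C' * K) * h ^ (r + s)" if "(h, z) \<in> T" for h z
  proof -
    have h: "norm (f h z) \<le> C * h ^ r" "norm (g h z) \<le> C' * h ^ s" using C that by auto
    have "norm (f h z) * norm (g h z) \<le> (C * h ^ r) * (C' * h ^ s)"
      by (rule mult_mono[OF h order_trans[OF norm_ge_zero h(1)] norm_ge_zero])
    from mult_right_mono[OF this K(1)]
    have "norm (f h z) * norm (g h z) * K \<le> (C * h ^ r) * (C' * h ^ s) * K" .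
    then show ?thesis using K(2)[of "f h z" "g h z"] by (simp add: power_add ac_simps)
  qed
  then show ?thesis unfolding big_O_def by blast
qed

lemma big_O_lipschitz_diff:
  assumes L: "L-lipschitz_on D f" and uv: "\<forall>(h, z)\<in>T. u h z \<in> D \<and> v h z \<in> D"
    and O: "big_O T r (\<lambda>h z. u h z - v h z)"
  shows "big_O T r (\<lambda>h z. f (u h z) - f (v h z))"
proof -
  obtain C where C: "\<forall>(h, z)\<in>T. norm (u h z - v h z) \<le> C * h ^ r"
    using O unfolding big_O_def by blast
  have "norm (f (u h z) - f (v h z)) \<le> (L * C) * h ^ r" if "(h, z) \<in> T" for h z
  proof -
    have "norm (f (u h z) - f (v h z)) \<le> L * norm (u h z - v h z)"
      using lipschitz_onD[OF L, of "u h z" "v h z"] uv that by (auto simp: dist_norm)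
    also have "\<dots> \<le> L * (C * h ^ r)"
      using C that lipschitz_on_nonneg[OF L] by (intro mult_left_mono) auto
    finally show ?thesis by (simp add: mult.assoc)
  qed
  then show ?thesis unfolding big_O_def by blast
qed

lemma big_O_lipschitz_bounded:
  assumes L: "L-lipschitz_on D f" and "compact D" and u: "\<forall>(h, z)\<in>T. u h z \<in> D"
  shows "big_O T 0 (\<lambda>h z. f (u h z))"
proof -
  have "bounded (f ` D)"
    using lipschitz_on_continuous_on[OF L] \<open>compact D\<close> compact_continuous_image compact_imp_bounded
    by blast
  then obtain C where "\<forall>x\<in>D. norm (f x) \<le> C" by (auto simp: bounded_iff)
  then show ?thesis using u unfolding big_O_def by (intro exI[of _ C]) auto
qed

section \<open>Successive stages of the fixed point iteration\<close>

text \<open>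
The step sizes are cut off at 1 so that higher powers of \<open>h\<close> are bounded by lower ones.  The set
depends on \<open>D\<close> but not on a set of initial values; this makes all constants below independent of
the latter.
\<close>

definition stage_set ::
    "'n::finite hamiltonian \<Rightarrow> ((real^'n) \<times> (real^'n)) set \<Rightarrow> nat \<Rightarrow> (real \<times> ((real^'n) \<times> (real^'n))) set" where
  "stage_set H D n = {(h, q, p). 0 \<le> h \<and> h \<le> 1 \<and> (\<forall>k\<le>n. (q, fp_iterate H h q p k) \<in> D)}"

abbreviation stage :: "'n::finite hamiltonian \<Rightarrow> nat \<Rightarrow> real \<Rightarrow> (real^'n) \<times> (real^'n) \<Rightarrow> (real^'n) \<times> (real^'n)" where
  "stage H n h z \<equiv> (fst z, fp_iterate H h (fst z) (snd z) n)"

lemma stage_set_step: "stage_set H D n \<subseteq> {0..1} \<times> UNIV"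
  by (auto simp: stage_set_def)

lemma stage_set_Suc_subset: "stage_set H D (Suc n) \<subseteq> stage_set H D n"
  by (auto simp: stage_set_def)

lemma stage_set_in: "k \<le> n \<Longrightarrow> \<forall>(h, z)\<in>stage_set H D n. stage H k h z \<in> D"
  by (auto simp: stage_set_def)

text \<open>
The first increment is \<open>- h H\<^sub>q\<close>, and \<open>H\<^sub>q\<close> is bounded; each further increment is \<open>h\<close> times a difference
of values of the Lipschitz function \<open>H\<^sub>q\<close> at the two previous stages.
\<close>

lemma stage_diff_big_O:
  assumes L: "L-lipschitz_on D (\<lambda>(q, p). grad_q H q p)" and "compact D"
  shows "big_O (stage_set H D (Suc n)) (Suc n) (\<lambda>h z. stage H (Suc n) h z - stage H n h z)"
proof (induction n)
  case 0
  have "big_O (stage_set H D (Suc 0)) (Suc 0)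
      (\<lambda>h z. h *\<^sub>R (0, - (case stage H 0 h z of (q, p) \<Rightarrow> grad_q H q p)))"
    using big_O_lipschitz_bounded[OF L \<open>compact D\<close> stage_set_in[of 0 "Suc 0"]]
    by (intro big_O_step stage_set_step) (simp add: big_O_def norm_Pair)
  moreover have "stage H (Suc 0) h z - stage H 0 h z
      = h *\<^sub>R (0, - (case stage H 0 h z of (q, p) \<Rightarrow> grad_q H q p))" for h z
    by (simp add: prod_eq_iff split_beta)
  ultimately show ?case by (simp only:)
next
  case (Suc n)
  let ?T = "stage_set H D (Suc (Suc n))"
  have "big_O ?T (Suc n) (\<lambda>h z. (case stage H n h z of (q, p) \<Rightarrow> grad_q H q p)
      - (case stage H (Suc n) h z of (q, p) \<Rightarrow> grad_q H q p))"
  proof (rule big_O_lipschitz_diff[OF L])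
    show "big_O ?T (Suc n) (\<lambda>h z. stage H n h z - stage H (Suc n) h z)"
      using big_O_subset[OF Suc stage_set_Suc_subset]
      by (simp add: big_O_def norm_minus_commute del: fp_iterate.simps diff_Pair)
  qed (auto simp: stage_set_def simp del: fp_iterate.simps)
  then have "big_O ?T (Suc (Suc n)) (\<lambda>h z. h *\<^sub>R (0, (case stage H n h z of (q, p) \<Rightarrow> grad_q H q p)
      - (case stage H (Suc n) h z of (q, p) \<Rightarrow> grad_q H q p)))"
    by (intro big_O_step stage_set_step) (simp add: big_O_def norm_Pair)
  moreover have "stage H (Suc (Suc n)) h z - stage H (Suc n) h z
      = h *\<^sub>R (0, (case stage H n h z of (q, p) \<Rightarrow> grad_q H q p)
      - (case stage H (Suc n) h z of (q, p) \<Rightarrow> grad_q H q p))" for h z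
    by (simp add: prod_eq_iff scaleR_diff_right)
  ultimately show ?case by (simp only:)
qed

context
  fixes H :: "'n::finite hamiltonian" and D :: "((real^'n) \<times> (real^'n)) set" and L L'
  assumes L: "L-lipschitz_on D (\<lambda>(q, p). grad_q H q p)"
    and L': "L'-lipschitz_on D (hessian_block H q_axis p_axis)"
    and D: "compact D"
begin

abbreviation Hqp :: "nat \<Rightarrow> real \<Rightarrow> (real^'n) \<times> (real^'n) \<Rightarrow> real^'n^'n" where
  "Hqp n h z \<equiv> hessian_block H q_axis p_axis (stage H n h z)"

abbreviation P :: "nat \<Rightarrow> real \<Rightarrow> (real^'n) \<times> (real^'n) \<Rightarrow> real^'n^'n" where
  "P n h z \<equiv> dp_iterate H h (fst z) (snd z) n"

lemmas big_O_matrix_mult = bounded_bilinear.big_O_prod[OF bounded_bilinear_matrix_mult]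

lemma Hqp_bounded: "k \<le> n \<Longrightarrow> big_O (stage_set H D n) 0 (Hqp k)"
  by (intro big_O_lipschitz_bounded[OF L' D] stage_set_in)

lemma dp_iterate_bounded: "big_O (stage_set H D n) 0 (P n)"
proof (induction n)
  case 0
  show ?case using big_O_const by simp
next
  case (Suc n)
  have "big_O (stage_set H D (Suc n)) (0 + 0) (\<lambda>h z. Hqp n h z ** P n h z)"
    by (intro big_O_matrix_mult Hqp_bounded big_O_subset[OF Suc] stage_set_Suc_subset stage_set_step) simp
  then have "big_O (stage_set H D (Suc n)) 0 (\<lambda>h z. h *\<^sub>R (Hqp n h z ** P n h z))"
    by (intro big_O_Suc_imp[OF big_O_step stage_set_step] stage_set_step) simp
  then show ?case using big_O_diff[OF big_O_const] by simp
qed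

text \<open>
The product difference splits as \<open>B\<^bsub>n+1\<^esub> (P\<^bsub>n+1\<^esub> - P\<^sub>n) + (B\<^bsub>n+1\<^esub> - B\<^sub>n) P\<^sub>n\<close>, so a bound on
\<open>P\<^bsub>n+1\<^esub> - P\<^sub>n\<close> yields one on \<open>B\<^bsub>n+1\<^esub> P\<^bsub>n+1\<^esub> - B\<^sub>n P\<^sub>n\<close>.  Conversely
\<open>P\<^bsub>n+2\<^esub> - P\<^bsub>n+1\<^esub>\<close> is \<open>- h\<close> times the latter, which raises the order and closes the induction.
\<close>

lemma Hqp_mult_dp_iterate_diff_big_O:
  "big_O (stage_set H D (Suc n)) (Suc n) (\<lambda>h z. Hqp (Suc n) h z ** P (Suc n) h z - Hqp n h z ** P n h z)"
proof (induction n)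
  interpret mm: bounded_bilinear "\<lambda>(A :: real^'n^'n) (B :: real^'n^'n). A ** B"
    by (rule bounded_bilinear_matrix_mult)
  have telescope: "big_O (stage_set H D (Suc n)) (Suc n)
      (\<lambda>h z. Hqp (Suc n) h z ** P (Suc n) h z - Hqp n h z ** P n h z)"
    if P_diff: "big_O (stage_set H D (Suc n)) (Suc n) (\<lambda>h z. P (Suc n) h z - P n h z)" for n
  proof -
    let ?T = "stage_set H D (Suc n)"
    have "big_O ?T (0 + Suc n) (\<lambda>h z. Hqp (Suc n) h z ** (P (Suc n) h z - P n h z))"
      by (intro big_O_matrix_mult Hqp_bounded P_diff stage_set_step) simp
    moreover have "big_O ?T (Suc n) (\<lambda>h z. Hqp (Suc n) h z - Hqp n h z)"
      using stage_set_in[of "Suc n" "Suc n" H D] stage_set_in[of n "Suc n" H D]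
      by (intro big_O_lipschitz_diff[OF L'] stage_diff_big_O[OF L D])
        (auto simp del: fp_iterate.simps)
    then have "big_O ?T (Suc n + 0) (\<lambda>h z. (Hqp (Suc n) h z - Hqp n h z) ** P n h z)"
      by (intro big_O_matrix_mult big_O_subset[OF dp_iterate_bounded] stage_set_Suc_subset stage_set_step)
    ultimately have "big_O ?T (Suc n) (\<lambda>h z. Hqp (Suc n) h z ** (P (Suc n) h z - P n h z)
        + (Hqp (Suc n) h z - Hqp n h z) ** P n h z)"
      using big_O_add by simp
    then show ?thesis
      by (simp add: mm.diff_left mm.diff_right del: fp_iterate.simps dp_iterate.simps)
  qed
  {
    case 0
    have "big_O (stage_set H D (Suc 0)) (Suc 0) (\<lambda>h z. h *\<^sub>R (0 - Hqp 0 h z ** P 0 h z))"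
      using big_O_matrix_mult[OF Hqp_bounded[of 0 "Suc 0"] big_O_const[of _ "mat 1"] stage_set_step]
      by (intro big_O_step stage_set_step) (simp add: big_O_def)
    then show ?case by (intro telescope) simp
  next
    case (Suc n)
    have "big_O (stage_set H D (Suc (Suc n))) (Suc (Suc n))
        (\<lambda>h z. h *\<^sub>R - (Hqp (Suc n) h z ** P (Suc n) h z - Hqp n h z ** P n h z))"
      using big_O_subset[OF Suc stage_set_Suc_subset]
      by (intro big_O_step stage_set_step)
        (simp add: big_O_def norm_minus_commute del: fp_iterate.simps dp_iterate.simps)
    moreover have "P (Suc (Suc n)) h z - P (Suc n) h z
        = h *\<^sub>R - (Hqp (Suc n) h z ** P (Suc n) h z - Hqp n h z ** P n h z)" for h z
    proof -
      have "P (Suc (Suc n)) h z - P (Suc n) h z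
          = (mat 1 - h *\<^sub>R (Hqp (Suc n) h z ** P (Suc n) h z)) - (mat 1 - h *\<^sub>R (Hqp n h z ** P n h z))"
        by (simp only: dp_iterate.simps(2))
      then show ?thesis
        by (simp add: scaleR_diff_right del: fp_iterate.simps dp_iterate.simps)
    qed
    ultimately show ?case by (intro telescope) (simp del: fp_iterate.simps dp_iterate.simps)
  }
qed

end

section \<open>The order of the defect\<close>

theorem theorem1:
  fixes H :: "(real^'n) \<times> (real^'n) \<Rightarrow> real"
    and D :: "((real^'n) \<times> (real^'n)) set"
    and M :: nat
  assumes "compact D" and "convex D"
    and "smooth_near H D"
    and "M \<ge> 1"
  shows "\<exists>C. \<forall>S h0. step_admissible H D M S h0 \<longrightarrow>
    (\<forall>\<^sub>F h in at 0 within {0<..h0}. \<forall>z\<in>S.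
       norm (A_block (num_flow H M h) z - mat 1) \<le> C * h ^ (M + 1))"
proof -
  obtain U where U: "open U" "D \<subseteq> U" and smooth: "\<And>k. C_k_on k U H"
    using \<open>smooth_near H D\<close> unfolding smooth_near_def by blast
  obtain m where M: "M = Suc m" using \<open>M \<ge> 1\<close> by (cases M) auto
  have C2: "C_k_on 2 U H" by (rule smooth)
  have smooth1: "C_k_on k U (\<lambda>x. frechet_derivative H (at x) v)" for k v
    by (rule C_k_on_Suc_derivative[OF smooth])
  then have smooth2: "C_k_on k U (hessian H v w)" for k v w
    using C_k_on_Suc_derivative unfolding hessian_def[abs_def] by blast
  have "\<exists>L. L-lipschitz_on D (directional_gradient H q_axis)"
    unfolding directional_gradient_def[abs_def]
    by (intro lipschitz_on_vec_lambda lipschitz_on_compact_convex[OF smooth1 assms(1,2) U(2)])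
  then obtain L where "L-lipschitz_on D (directional_gradient H q_axis)" ..
  then have L: "L-lipschitz_on D (\<lambda>(q, p). grad_q H q p)"
    using C2 U(2) by (subst lipschitz_on_cong)
     (auto simp: grad_q_eq_directional_gradient numeral_2_eq_2 subset_iff)
  have "\<exists>L'. L'-lipschitz_on D (hessian_block H q_axis p_axis)"
    unfolding hessian_block_def[abs_def]
    by (intro lipschitz_on_vec_lambda lipschitz_on_compact_convex[OF smooth2 assms(1,2) U(2)])
  then obtain L' where L': "L'-lipschitz_on D (hessian_block H q_axis p_axis)" ..
  let ?HP = "\<lambda>k h z. hessian_block H q_axis p_axis (stage H k h z) ** dp_iterate H h (fst z) (snd z) k"
  have A: "A_block (num_flow H M h) z - mat 1 = h *\<^sub>R (?HP (Suc m) h z - ?HP m h z)"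
    if "(h, z) \<in> stage_set H D M" for h z
  proof -
    have "(fst z, fp_iterate H h (fst z) (snd z) k) \<in> U" if "k \<le> Suc m" for k
      using stage_set_in[of k M H D] that \<open>(h, z) \<in> stage_set H D M\<close> U(2) unfolding M by blast
    from A_block_num_flow_Suc[OF U(1) C2 this] show ?thesis by (simp only: M prod.collapse)
  qed
  have "big_O (stage_set H D M) (Suc M) (\<lambda>h z. h *\<^sub>R (?HP (Suc m) h z - ?HP m h z))"
    unfolding M by (intro big_O_step Hqp_mult_dp_iterate_diff_big_O[OF L L' assms(1)] stage_set_step)
  then have "big_O (stage_set H D M) (Suc M) (\<lambda>h z. A_block (num_flow H M h) z - mat 1)"
    by (subst big_O_cong[OF A])
  then obtain C where C: "\<And>h z. (h, z) \<in> stage_set H D M \<Longrightarrow>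
      norm (A_block (num_flow H M h) z - mat 1) \<le> C * h ^ (M + 1)"
    unfolding big_O_def by auto
  show ?thesis
  proof (intro exI allI impI)
    fix S h0 assume adm: "step_admissible H D M S h0"
    have "norm (A_block (num_flow H M h) z - mat 1) \<le> C * h ^ (M + 1)"
      if "h \<in> {0<..h0}" "dist h 0 < 1" "z \<in> S" for h z
    proof (rule C)
      obtain q p where z: "z = (q, p)" by (cases z)
      have h: "0 < h" "h \<le> h0" "h \<le> 1" using that by (auto simp: dist_real_def)
      then have "\<forall>n\<le>M. (q, fp_iterate H h q p n) \<in> D"
        using adm \<open>z \<in> S\<close> unfolding step_admissible_def z by blast
      with h show "(h, z) \<in> stage_set H D M"
        by (simp add: stage_set_def z)
    qed
    \<comment> \<open>the radius 1 is the cut-off in \<open>stage_set\<close>\<close>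
    then show "\<forall>\<^sub>F h in at 0 within {0<..h0}. \<forall>z\<in>S.
        norm (A_block (num_flow H M h) z - mat 1) \<le> C * h ^ (M + 1)"
      unfolding eventually_at by (intro exI[of _ 1]) auto
  qed
qed

end
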